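(* Let $(X_i,Y_i)$, $i=1,\dots,n$, be i.i.d. observations from the linear model $Y=\beta_0^TX+\epsilon$, where $\beta_0\in\mathbb R^d$, $X$ and $\epsilon$ are independent, $X$ has a density $f^X$ with respect to Lebesgue measure on $\mathbb R^d$, and $\epsilon$ has density $f^\epsilon(t)=s_0^{-1}f(t/s_0)$ with $s_0\in(0,\infty)$ and $f$ a known even, bounded and continuous probability density on $\mathbb R$ with $\int_{\mathbb R}t^2f(t)\,dt<\infty$. Assume that there exist $\alpha>0$ and $C>0$ such that $f(t)\le C\exp(-|t|^\alpha)$ for all $t\in\mathbb R$. For any fixed $n\ge 1$, assume further that (i) there exists no vector $v\in\mathbb R^d\setminus\{0\}$ such that $v^TX_i=0$ for all $i=1,\dots,n$; (ii) there exists no vector $\beta\in\mathbb R^d$ such that $Y_i=\beta^TX_i$ for all $i=1,\dots,n$. Then there exists at least one maximum likelihood estimator $(\widehat\beta_n,\widehat s_n)\in\mathbb R^d\times(0,\infty)$, i.e. at least one maximizer over $\mathbb R^d\times(0,\infty)$ of $$\ell_n(\beta,s)=-n\log s+\sum_{i=1}^n\log f\left(\frac{Y_i-\beta^TX_i}{s}\right).$$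
   Context: Here $d\ge1$ is an integer. The parameters $\beta_0\in\mathbb R^d$ and $s_0\in(0,\infty)$ are the true unknown regression vector and scale. The function $\ell_n$ is the (conditional) log-likelihood of the sample, with the convention $\log 0=-\infty$. Conditions (i) and (ii) are conditions on the observed sample. *)

theory Defs
  imports "HOL-Probability.Probability"
begin

text \<open>Logarithm with the convention \<open>log 0 = -\<infinity>\<close> (the real \<open>ln\<close> has \<open>ln 0 = 0\<close>).\<close>

definition elog :: "real \<Rightarrow> ereal" where
  "elog u = (if u \<le> 0 then -\<infinity> else ereal (ln u))"

text \<open>
  Independence of \<open>X\<close> and \<open>\<epsilon>\<close> is stated through the \<open>\<sigma>\<close>-algebras they generate, since \<open>indep_var\<close>
  requires both variables to have the same codomain type.
\<close>

definition linear_model ::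
  "'v measure \<Rightarrow> real ^ 'd \<Rightarrow> real \<Rightarrow> (real \<Rightarrow> real) \<Rightarrow> (real ^ 'd \<Rightarrow> real) \<Rightarrow>
    ('v \<Rightarrow> real ^ 'd) \<Rightarrow> ('v \<Rightarrow> real) \<Rightarrow> ('v \<Rightarrow> real) \<Rightarrow> bool" where
  "linear_model N \<beta>\<^sub>0 s\<^sub>0 f fX X \<epsilon> Y \<longleftrightarrow>
     (\<forall>\<omega>\<in>space N. Y \<omega> = \<beta>\<^sub>0 \<bullet> X \<omega> + \<epsilon> \<omega>) \<and>
     prob_space.indep_set N {X -` A \<inter> space N |A. A \<in> sets borel}
       {\<epsilon> -` B \<inter> space N |B. B \<in> sets borel} \<and>
     (\<forall>x. 0 \<le> fX x) \<and> distributed N lborel X (\<lambda>x. ennreal (fX x)) \<and>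
     distributed N lborel \<epsilon> (\<lambda>t. ennreal (f (t / s\<^sub>0) / s\<^sub>0))"

definition iid_copies ::
  "'w measure \<Rightarrow> nat \<Rightarrow> (nat \<Rightarrow> 'w \<Rightarrow> 'b::topological_space) \<Rightarrow> 'v measure \<Rightarrow> ('v \<Rightarrow> 'b) \<Rightarrow> bool" where
  "iid_copies M n Z N Z\<^sub>0 \<longleftrightarrow>
     prob_space.indep_vars M (\<lambda>_. borel) Z {1..n} \<and>
     (\<forall>i\<in>{1..n}. distr M borel (Z i) = distr N borel Z\<^sub>0)"

text \<open>Observed values \<open>x i\<close>, \<open>y i\<close> are indexed by \<open>i = 1, \<dots>, n\<close>.\<close>

definition loglik ::
  "(real \<Rightarrow> real) \<Rightarrow> nat \<Rightarrow> (nat \<Rightarrow> real ^ 'd) \<Rightarrow> (nat \<Rightarrow> real) \<Rightarrow> real ^ 'd \<Rightarrow> real \<Rightarrow> ereal" where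
  "loglik f n x y \<beta> s =
     ereal (- real n * ln s) + (\<Sum>i=1..n. elog (f ((y i - \<beta> \<bullet> x i) / s)))"

definition is_mle ::
  "(real \<Rightarrow> real) \<Rightarrow> nat \<Rightarrow> (nat \<Rightarrow> real ^ 'd) \<Rightarrow> (nat \<Rightarrow> real) \<Rightarrow> real ^ 'd \<Rightarrow> real \<Rightarrow> bool" where
  "is_mle f n x y \<beta> s \<longleftrightarrow>
     is_arg_max (\<lambda>(b, r). loglik f n x y b r) (\<lambda>p. p \<in> UNIV \<times> {0<..}) (\<beta>, s)"

end

theory Submission
  imports Defs "HOL-Real_Asymp.Real_Asymp"
begin

text \<open>
  The likelihood is continuous on \<open>\<real>\<^sup>d \<times> (0,\<infinity>)\<close>, so it suffices to show that it tends to \<open>0\<close> at the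
  boundary. With \<open>R(\<beta>) = \<Sum>\<^sub>i \<bar>y\<^sub>i - \<beta> \<bullet> x\<^sub>i\<bar>\<close>, the tail bound gives
  \<open>L(\<beta>, s) \<le> (C / s)\<^sup>n exp (- (R(\<beta>) / (n s))\<^sup>\<alpha>)\<close>. It vanishes as \<open>s \<rightarrow> \<infinity>\<close>; condition (ii)
  bounds \<open>R\<close> away from \<open>0\<close>, so the exponential beats \<open>s\<^sup>-\<^sup>n\<close> as \<open>s \<rightarrow> 0\<close>; and condition (i)
  makes \<open>R\<close> coercive, which settles \<open>\<parallel>\<beta>\<parallel> \<rightarrow> \<infinity>\<close> for \<open>s\<close> in a compact interval. If \<open>L\<close> vanishes
  identically, every point is a maximizer.
\<close>

section \<open>From the extended log-likelihood to a real likelihood\<close>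

text \<open>A zero factor is harmless: \<open>elog\<close> never takes the value \<infinity>, so
  adding -\<infinity> always yields -\<infinity>.\<close>

lemma elog_mult:
  assumes "0 \<le> a" "0 \<le> b"
  shows "elog (a * b) = elog a + elog b"
  using assms by (auto simp: elog_def ln_mult mult_le_0_iff)

lemma elog_prod:
  assumes "finite I" "\<And>i. i \<in> I \<Longrightarrow> 0 \<le> g i"
  shows "elog (\<Prod>i\<in>I. g i) = (\<Sum>i\<in>I. elog (g i))"
  using assms by (induction I rule: finite_induct) (auto simp: elog_mult prod_nonneg elog_def[of 1])

lemma elog_mono: "a \<le> b \<Longrightarrow> elog a \<le> elog b"
  by (auto simp: elog_def)

text \<open>The exponential of the log-likelihood. Being real-valued and continuous even where f
  vanishes, it admits the usual compactness arguments.\<close>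

definition lik ::
  "(real \<Rightarrow> real) \<Rightarrow> nat \<Rightarrow> (nat \<Rightarrow> 'a::real_inner) \<Rightarrow> (nat \<Rightarrow> real) \<Rightarrow> 'a \<Rightarrow> real \<Rightarrow> real" where
  "lik f n x y \<beta> s = (1 / s) ^ n * (\<Prod>i=1..n. f ((y i - \<beta> \<bullet> x i) / s))"

lemma loglik_eq_elog_lik:
  assumes "\<And>t. 0 \<le> f t" "0 < s"
  shows "loglik f n x y \<beta> s = elog (lik f n x y \<beta> s)"
proof -
  have pos: "0 < (1 / s) ^ n" using assms(2) by simp
  have "ln ((1 / s) ^ n) = - real n * ln s"
    using assms(2) by (simp add: ln_realpow ln_div)
  with pos have "elog ((1 / s) ^ n) = ereal (- real n * ln s)"
    by (simp add: elog_def not_le)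
  with pos assms(1) show ?thesis
    by (simp add: loglik_def lik_def elog_mult elog_prod prod_nonneg)
qed

lemma continuous_on_lik:
  assumes "continuous_on UNIV f"
  shows "continuous_on (UNIV \<times> {0<..}) (\<lambda>(\<beta>, s). lik f n x y \<beta> s)"
  unfolding lik_def split_beta
  by (intro continuous_intros continuous_on_compose2[OF assms]) auto

section \<open>Growth and positivity of the absolute residual sum\<close>

text \<open>The right-hand side is a seminorm, and nondegeneracy makes it a norm. Its minimum over
  the compact unit sphere is the constant c; homogeneity does the rest.\<close>

lemma sum_abs_inner_ge_norm:
  fixes x :: "'i \<Rightarrow> 'a::euclidean_space"
  assumes "finite I" and nondeg: "\<not> (\<exists>v. v \<noteq> 0 \<and> (\<forall>i\<in>I. v \<bullet> x i = 0))"
  obtains c where "0 < c" "\<And>\<beta>. c * norm \<beta> \<le> (\<Sum>i\<in>I. \<bar>\<beta> \<bullet> x i\<bar>)"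
proof -
  let ?h = "\<lambda>\<beta>. \<Sum>i\<in>I. \<bar>\<beta> \<bullet> x i\<bar>"
  obtain b :: 'a where "b \<in> Basis" using nonempty_Basis by blast
  then have "sphere (0::'a) 1 \<noteq> {}" by (auto intro!: exI[of _ b])
  moreover have "continuous_on (sphere 0 1) ?h" by (intro continuous_intros)
  ultimately obtain u where u: "norm u = 1" "\<And>v. norm v = 1 \<Longrightarrow> ?h u \<le> ?h v"
    using continuous_attains_inf[OF compact_sphere, of 0 1 ?h] by auto
  have "?h u \<noteq> 0"
  proof
    assume "?h u = 0"
    then have "\<forall>i\<in>I. u \<bullet> x i = 0" using \<open>finite I\<close> by (simp add: sum_nonneg_eq_0_iff)
    moreover have "u \<noteq> 0" using u(1) by auto
    ultimately show False using nondeg by blast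
  qed
  then have "0 < ?h u" by (simp add: order.strict_iff_order sum_nonneg)
  moreover have "?h u * norm \<beta> \<le> ?h \<beta>" for \<beta>
  proof (cases "\<beta> = 0")
    case False
    then have "?h u \<le> ?h (\<beta> /\<^sub>R norm \<beta>)" by (intro u(2)) simp
    also have "\<dots> = ?h \<beta> / norm \<beta>"
      by (simp add: abs_mult divide_inverse_commute flip: sum_distrib_left)
    finally show ?thesis using False by (simp add: field_simps)
  qed simp
  ultimately show thesis using that by blast
qed

lemma sum_abs_residual_ge_norm:
  fixes x :: "'i \<Rightarrow> 'a::euclidean_space"
  assumes "finite I" and nondeg: "\<not> (\<exists>v. v \<noteq> 0 \<and> (\<forall>i\<in>I. v \<bullet> x i = 0))"
  obtains c B where "0 < c" "\<And>\<beta>. c * norm \<beta> - B \<le> (\<Sum>i\<in>I. \<bar>y i - \<beta> \<bullet> x i\<bar>)"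
proof -
  obtain c where c: "0 < c" "\<And>\<beta>. c * norm \<beta> \<le> (\<Sum>i\<in>I. \<bar>\<beta> \<bullet> x i\<bar>)"
    using sum_abs_inner_ge_norm[OF assms] by blast
  have "c * norm \<beta> - (\<Sum>i\<in>I. \<bar>y i\<bar>) \<le> (\<Sum>i\<in>I. \<bar>y i - \<beta> \<bullet> x i\<bar>)" for \<beta>
  proof -
    have "(\<Sum>i\<in>I. \<bar>\<beta> \<bullet> x i\<bar>) \<le> (\<Sum>i\<in>I. \<bar>y i - \<beta> \<bullet> x i\<bar> + \<bar>y i\<bar>)"
      by (intro sum_mono) linarith
    with c(2)[of \<beta>] show ?thesis by (simp add: sum.distrib)
  qed
  with c(1) show thesis using that by blast
qed

text \<open>No single residual sum vanishes, but a uniform bound needs an attained minimum: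
  coercivity reduces the problem to a compact ball.\<close>

lemma sum_abs_residual_bounded_below:
  fixes x :: "'i \<Rightarrow> 'a::euclidean_space"
  assumes "finite I" and nondeg: "\<not> (\<exists>v. v \<noteq> 0 \<and> (\<forall>i\<in>I. v \<bullet> x i = 0))"
    and nofit: "\<not> (\<exists>\<beta>. \<forall>i\<in>I. y i = \<beta> \<bullet> x i)"
  obtains \<delta> where "0 < \<delta>" "\<And>\<beta>. \<delta> \<le> (\<Sum>i\<in>I. \<bar>y i - \<beta> \<bullet> x i\<bar>)"
proof -
  let ?R = "\<lambda>\<beta>. \<Sum>i\<in>I. \<bar>y i - \<beta> \<bullet> x i\<bar>"
  obtain c B where c: "0 < c" "\<And>\<beta>. c * norm \<beta> - B \<le> ?R \<beta>"
    using sum_abs_residual_ge_norm[OF assms(1,2)] by blast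
  \<comment> \<open>Outside this radius the residual sum is at least 1. The absolute value keeps the
    ball nonempty, since the sign of B is unknown.\<close>
  let ?K = "cball (0::'a) \<bar>(B + 1) / c\<bar>"
  have "continuous_on ?K ?R" by (intro continuous_intros)
  then obtain b where b: "\<And>\<beta>. \<beta> \<in> ?K \<Longrightarrow> ?R b \<le> ?R \<beta>"
    using continuous_attains_inf[OF compact_cball, of 0 "\<bar>(B + 1) / c\<bar>" ?R] by fastforce
  have "?R b \<noteq> 0"
    using nofit \<open>finite I\<close> by (auto simp: sum_nonneg_eq_0_iff)
  then have "0 < min 1 (?R b)" by (simp add: order.strict_iff_order sum_nonneg)
  moreover have "min 1 (?R b) \<le> ?R \<beta>" for \<beta>
  proof (cases "\<beta> \<in> ?K")
    case False
    then have "(B + 1) / c < norm \<beta>" by (simp del: abs_divide)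
    then have "1 \<le> c * norm \<beta> - B" using c(1) by (simp add: field_simps)
    with c(2)[of \<beta>] show ?thesis by linarith
  qed (simp add: b min.coboundedI2)
  ultimately show thesis using that by blast
qed

section \<open>Tail bound and boundary limits of the likelihood\<close>

text \<open>Some residual is at least the average, and its exponential factor alone gives the decay.
  Allowing any lower bound r of the residual sum lets the same estimate serve every boundary
  regime.\<close>

lemma lik_le:
  assumes f_nonneg: "\<And>t. 0 \<le> f t" and f_tail: "\<And>t. f t \<le> C * exp (- (\<bar>t\<bar> powr \<alpha>))"
    and "0 < \<alpha>" "0 < C" "0 < s" "1 \<le> n"
    and r: "0 \<le> r" "r \<le> (\<Sum>i=1..n. \<bar>y i - \<beta> \<bullet> x i\<bar>)"
  shows "lik f n x y \<beta> s \<le> (C / s) ^ n * exp (- ((r / (real n * s)) powr \<alpha>))"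
proof -
  let ?t = "\<lambda>i. (y i - \<beta> \<bullet> x i) / s"
  have "\<exists>j\<in>{1..n}. r / real n \<le> \<bar>y j - \<beta> \<bullet> x j\<bar>"
  proof (rule ccontr)
    assume "\<not> ?thesis"
    then have "(\<Sum>i=1..n. \<bar>y i - \<beta> \<bullet> x i\<bar>) < (\<Sum>i=1..n. r / real n)"
      using \<open>1 \<le> n\<close> by (intro sum_strict_mono) (auto simp: not_le)
    with r(2) \<open>1 \<le> n\<close> show False by simp
  qed
  then obtain j where j: "j \<in> {1..n}" "r / real n \<le> \<bar>y j - \<beta> \<bullet> x j\<bar>" by blast
  have "r / (real n * s) = r / real n / s" by simp
  also have "\<dots> \<le> \<bar>?t j\<bar>" using j(2) \<open>0 < s\<close> by (simp add: abs_divide field_simps)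
  finally have "(r / (real n * s)) powr \<alpha> \<le> \<bar>?t j\<bar> powr \<alpha>"
    using r(1) \<open>0 < s\<close> \<open>0 < \<alpha>\<close> by (intro powr_mono2) auto
  also have "\<dots> \<le> (\<Sum>i=1..n. \<bar>?t i\<bar> powr \<alpha>)"
    using j(1) by (intro member_le_sum) auto
  finally have le: "(r / (real n * s)) powr \<alpha> \<le> (\<Sum>i=1..n. \<bar>?t i\<bar> powr \<alpha>)" .
  have "(\<Prod>i=1..n. f (?t i)) \<le> (\<Prod>i=1..n. C * exp (- (\<bar>?t i\<bar> powr \<alpha>)))"
    by (intro prod_mono conjI f_nonneg f_tail)
  also have "\<dots> = C ^ n * exp (- (\<Sum>i=1..n. \<bar>?t i\<bar> powr \<alpha>))"
    by (simp add: prod.distrib exp_sum[symmetric] sum_negf)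
  also have "\<dots> \<le> C ^ n * exp (- ((r / (real n * s)) powr \<alpha>))"
    using le \<open>0 < C\<close> by simp
  finally have "lik f n x y \<beta> s \<le> (1 / s) ^ n * (C ^ n * exp (- ((r / (real n * s)) powr \<alpha>)))"
    unfolding lik_def using \<open>0 < s\<close> by (intro mult_left_mono) auto
  then show ?thesis by (simp add: power_divide)
qed

lemma power_inverse_exp_tendsto_0_at_right:
  fixes \<alpha> k C :: real
  assumes "0 < \<alpha>" "0 < k"
  shows "((\<lambda>s. (C / s) ^ n * exp (- ((k / s) powr \<alpha>))) \<longlongrightarrow> 0) (at_right 0)"
proof -
  define m where "m = real n"
  \<comment> \<open>For s > 0 the power of 1 / s is a real power of s, and the factor
    \<open>C ^ n\<close> is split off as a constant.\<close>
  have "((\<lambda>s. C ^ n * (s powr - m * exp (- ((k / s) powr \<alpha>)))) \<longlongrightarrow> C ^ n * 0) (at_right 0)"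
    using assms by (intro tendsto_mult_left) real_asymp
  moreover have "\<forall>\<^sub>F s in at_right 0.
      C ^ n * (s powr - m * exp (- ((k / s) powr \<alpha>))) = (C / s) ^ n * exp (- ((k / s) powr \<alpha>))"
    using eventually_at_right_less[of 0]
    by eventually_elim (simp add: m_def powr_minus powr_realpow power_divide field_simps)
  ultimately show ?thesis by (simp add: tendsto_cong)
qed

lemma power_inverse_tendsto_0_at_top:
  fixes C :: real
  assumes "1 \<le> n"
  shows "((\<lambda>s. (C / s) ^ n) \<longlongrightarrow> 0) at_top"
proof -
  have "((\<lambda>s. C / s) \<longlongrightarrow> 0) at_top" by real_asymp
  from tendsto_power[OF this, of n] show ?thesis using assms by (simp add: power_0_left)
qed

lemma exp_neg_powr_tendsto_0:
  fixes \<alpha> k A :: real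
  assumes "0 < \<alpha>" "0 < k"
  shows "((\<lambda>r. A * exp (- ((r / k) powr \<alpha>))) \<longlongrightarrow> 0) at_top"
  using assms by real_asymp

text \<open>Confines a superlevel set at a positive level to a compact part of the open domain. The
  tail bound is used with r = \<delta> for small s, r = 0 for large s, and a large r for large
  \<beta> once s is confined.\<close>

lemma lik_superlevel_bounded:
  fixes x :: "nat \<Rightarrow> 'a::euclidean_space"
  assumes f_nonneg: "\<And>t. 0 \<le> f t" and f_tail: "\<And>t. f t \<le> C * exp (- (\<bar>t\<bar> powr \<alpha>))"
    and "0 < \<alpha>" "0 < C" "1 \<le> n" "0 < l"
    and nondeg: "\<not> (\<exists>v. v \<noteq> 0 \<and> (\<forall>i\<in>{1..n}. v \<bullet> x i = 0))"
    and nofit: "\<not> (\<exists>\<beta>. \<forall>i\<in>{1..n}. y i = \<beta> \<bullet> x i)"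
  obtains a b \<rho> where "0 < a"
    "\<And>\<beta> s. 0 < s \<Longrightarrow> l \<le> lik f n x y \<beta> s \<Longrightarrow> norm \<beta> \<le> \<rho> \<and> a \<le> s \<and> s \<le> b"
proof -
  let ?R = "\<lambda>\<beta>. \<Sum>i=1..n. \<bar>y i - \<beta> \<bullet> x i\<bar>"
  note bound = lik_le[OF f_nonneg f_tail \<open>0 < \<alpha>\<close> \<open>0 < C\<close> _ \<open>1 \<le> n\<close>]
  obtain \<delta> where \<delta>: "0 < \<delta>" "\<And>\<beta>. \<delta> \<le> ?R \<beta>"
    using sum_abs_residual_bounded_below[OF _ nondeg nofit] by auto
  obtain c B where c: "0 < c" "\<And>\<beta>. c * norm \<beta> - B \<le> ?R \<beta>"
    using sum_abs_residual_ge_norm[OF _ nondeg, of y] by auto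
  have "0 < \<delta> / real n" using \<delta>(1) \<open>1 \<le> n\<close> by simp
  from order_tendstoD(2)[OF power_inverse_exp_tendsto_0_at_right[OF \<open>0 < \<alpha>\<close> this] \<open>0 < l\<close>]
  obtain a where a: "0 < a" "\<And>s. 0 < s \<Longrightarrow> s < a \<Longrightarrow>
      (C / s) ^ n * exp (- ((\<delta> / real n / s) powr \<alpha>)) < l"
    unfolding eventually_at_right_field by blast
  from order_tendstoD(2)[OF power_inverse_tendsto_0_at_top[OF \<open>1 \<le> n\<close>] \<open>0 < l\<close>]
  obtain b where b: "\<And>s. b \<le> s \<Longrightarrow> (C / s) ^ n < l"
    unfolding eventually_at_top_linorder by blast
  \<comment> \<open>The maximum with a makes the upper end positive, so that it can serve as a scale
    in the next limit.\<close>
  define b' where "b' = max b a"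
  have "0 < real n * b'" using \<open>1 \<le> n\<close> \<open>0 < a\<close> by (simp add: b'_def)
  from order_tendstoD(2)[OF exp_neg_powr_tendsto_0[OF \<open>0 < \<alpha>\<close> this] \<open>0 < l\<close>]
  obtain r where r: "\<And>t. r \<le> t \<Longrightarrow> (C / a) ^ n * exp (- ((t / (real n * b')) powr \<alpha>)) < l"
    unfolding eventually_at_top_linorder by blast
  define r' where "r' = max r 0"
  have "norm \<beta> \<le> (r' + B) / c \<and> a \<le> s \<and> s \<le> b'" if "0 < s" "l \<le> lik f n x y \<beta> s" for \<beta> s
  proof -
    have "a \<le> s"
    proof (rule ccontr)
      assume "\<not> a \<le> s"
      with a(2)[of s] bound[OF \<open>0 < s\<close>, of \<delta> y \<beta> x] \<delta> that show False by fastforce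
    qed
    moreover have "s \<le> b'"
    proof (rule ccontr)
      assume "\<not> s \<le> b'"
      then have "(C / s) ^ n < l" by (intro b) (simp add: b'_def)
      \<comment> \<open>With r = 0 the exponential factor is 1, so the power alone bounds the
        likelihood.\<close>
      moreover have "(C / s) ^ n * exp (- ((0 / (real n * s)) powr \<alpha>)) = (C / s) ^ n" by simp
      ultimately show False
        using bound[OF \<open>0 < s\<close>, of 0 y \<beta> x] that by (simp add: sum_nonneg)
    qed
    moreover have "norm \<beta> \<le> (r' + B) / c"
    proof (rule ccontr)
      assume "\<not> ?thesis"
      then have "r' \<le> ?R \<beta>" using c(1) c(2)[of \<beta>] by (simp add: field_simps)
      then have "lik f n x y \<beta> s \<le> (C / s) ^ n * exp (- ((r' / (real n * s)) powr \<alpha>))"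
        by (intro bound \<open>0 < s\<close>) (auto simp: r'_def)
      \<comment> \<open>Each factor is replaced by its worst case over a \<le> s \<le>
        \<open>b'\<close>: the power at a, the exponential at \<open>b'\<close>. The result no
        longer depends on s.\<close>
      also have "\<dots> \<le> (C / a) ^ n * exp (- ((r' / (real n * b')) powr \<alpha>))"
      proof (rule mult_mono)
        show "(C / s) ^ n \<le> (C / a) ^ n"
          using \<open>a \<le> s\<close> \<open>0 < a\<close> \<open>0 < C\<close> by (intro power_mono divide_left_mono) auto
        have "(r' / (real n * b')) powr \<alpha> \<le> (r' / (real n * s)) powr \<alpha>"
          using \<open>s \<le> b'\<close> \<open>0 < s\<close> \<open>1 \<le> n\<close> \<open>0 < \<alpha>\<close>
          by (intro powr_mono2 divide_left_mono mult_left_mono) (auto simp: r'_def)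
        then show "exp (- ((r' / (real n * s)) powr \<alpha>)) \<le> exp (- ((r' / (real n * b')) powr \<alpha>))"
          by simp
      qed (use \<open>0 < C\<close> \<open>0 < a\<close> in auto)
      also have "\<dots> < l" by (intro r) (simp add: r'_def)
      finally show False using that by simp
    qed
    ultimately show ?thesis by simp
  qed
  with a(1) show thesis using that by blast
qed

section \<open>Existence of a maximizer\<close>

lemma lik_attains_max:
  fixes x :: "nat \<Rightarrow> 'a::euclidean_space"
  assumes f_nonneg: "\<And>t. 0 \<le> f t" and f_tail: "\<And>t. f t \<le> C * exp (- (\<bar>t\<bar> powr \<alpha>))"
    and f_cont: "continuous_on UNIV f"
    and "0 < \<alpha>" "0 < C" "1 \<le> n"
    and nondeg: "\<not> (\<exists>v. v \<noteq> 0 \<and> (\<forall>i\<in>{1..n}. v \<bullet> x i = 0))"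
    and nofit: "\<not> (\<exists>\<beta>. \<forall>i\<in>{1..n}. y i = \<beta> \<bullet> x i)"
  obtains \<beta> s where "0 < s" "\<And>\<beta>' s'. 0 < s' \<Longrightarrow> lik f n x y \<beta>' s' \<le> lik f n x y \<beta> s"
proof (cases "\<exists>\<beta> s. 0 < s \<and> 0 < lik f n x y \<beta> s")
  case False
  \<comment> \<open>The likelihood is nowhere positive here, so the arbitrary point \<beta> = 0, s =
    1 is a maximizer.\<close>
  have "0 \<le> lik f n x y 0 1" by (simp add: lik_def f_nonneg prod_nonneg)
  with False that[of 1 0] show thesis by (meson less_le_trans not_le zero_less_one)
next
  case True
  then obtain \<beta>\<^sub>1 s\<^sub>1 where 1: "0 < s\<^sub>1" "0 < lik f n x y \<beta>\<^sub>1 s\<^sub>1" by blast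
  obtain a b \<rho> where "0 < a" and K: "\<And>\<beta> s. 0 < s \<Longrightarrow> lik f n x y \<beta>\<^sub>1 s\<^sub>1 \<le> lik f n x y \<beta> s \<Longrightarrow>
      norm \<beta> \<le> \<rho> \<and> a \<le> s \<and> s \<le> b"
    using lik_superlevel_bounded[OF f_nonneg f_tail \<open>0 < \<alpha>\<close> \<open>0 < C\<close> \<open>1 \<le> n\<close> 1(2) nondeg nofit]
    by metis
  let ?K = "cball (0::'a) \<rho> \<times> {a..b}"
  let ?L = "\<lambda>(\<beta>, s). lik f n x y \<beta> s"
  have in_K: "(\<beta>\<^sub>1, s\<^sub>1) \<in> ?K" using K[OF 1(1) order_refl] by simp
  have "continuous_on ?K ?L"
    by (rule continuous_on_subset[OF continuous_on_lik[OF f_cont]]) (use \<open>0 < a\<close> in auto)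
  then obtain p where p: "p \<in> ?K" "\<And>q. q \<in> ?K \<Longrightarrow> ?L q \<le> ?L p"
    using continuous_attains_sup[of ?K ?L] in_K by (metis compact_Icc compact_Times compact_cball empty_iff)
  obtain \<beta> s where [simp]: "p = (\<beta>, s)" by (cases p)
  have "lik f n x y \<beta>' s' \<le> lik f n x y \<beta> s" if "0 < s'" for \<beta>' s'
  proof (cases "lik f n x y \<beta>\<^sub>1 s\<^sub>1 \<le> lik f n x y \<beta>' s'")
    case True
    from K[OF that this] p(2)[of "(\<beta>', s')"] show ?thesis by simp
  next
    case False
    \<comment> \<open>Below the reference level, the value is beaten by the one at
      \<open>(\<beta>\<^sub>1, s\<^sub>1)\<close>, which lies in the compact set.\<close>
    with p(2)[OF in_K] show ?thesis by simp
  qed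
  moreover have "0 < s" using p(1) \<open>0 < a\<close> by simp
  ultimately show thesis using that by blast
qed

theorem theorem1:
  fixes M :: "'w measure" and N :: "'v measure"
    and n :: nat
    and X :: "nat \<Rightarrow> 'w \<Rightarrow> real ^ 'd" and Y :: "nat \<Rightarrow> 'w \<Rightarrow> real"
    and X\<^sub>0 :: "'v \<Rightarrow> real ^ 'd" and \<epsilon>\<^sub>0 Y\<^sub>0 :: "'v \<Rightarrow> real"
    and \<beta>\<^sub>0 :: "real ^ 'd" and s\<^sub>0 :: real
    and f :: "real \<Rightarrow> real" and fX :: "real ^ 'd \<Rightarrow> real"
    and \<alpha> C :: real
    and \<omega> :: 'w
  assumes "prob_space M" and "prob_space N"
    and s0_pos: "0 < s\<^sub>0"
    and model: "linear_model N \<beta>\<^sub>0 s\<^sub>0 f fX X\<^sub>0 \<epsilon>\<^sub>0 Y\<^sub>0"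
    and iid: "iid_copies M n (\<lambda>i w. (X i w, Y i w)) N (\<lambda>v. (X\<^sub>0 v, Y\<^sub>0 v))"
    and f_nonneg: "\<And>t. 0 \<le> f t"
    and f_density: "has_bochner_integral lborel f 1"
    and f_even: "\<And>t. f (- t) = f t"
    and f_bounded: "bounded (range f)"
    and f_cont: "continuous_on UNIV f"
    and f_moment: "integrable lborel (\<lambda>t. t\<^sup>2 * f t)"
    and "0 < \<alpha>" and "0 < C"
    and f_tail: "\<And>t. f t \<le> C * exp (- (\<bar>t\<bar> powr \<alpha>))"
    and n_pos: "1 \<le> n"
    and \<omega>: "\<omega> \<in> space M"
    and i: "\<not> (\<exists>v. v \<noteq> 0 \<and> (\<forall>i\<in>{1..n}. v \<bullet> X i \<omega> = 0))"
    and ii: "\<not> (\<exists>\<beta>. \<forall>i\<in>{1..n}. Y i \<omega> = \<beta> \<bullet> X i \<omega>)"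
  shows "\<exists>\<beta> s. is_mle f n (\<lambda>i. X i \<omega>) (\<lambda>i. Y i \<omega>) \<beta> s"
proof -
  obtain \<beta> s where s: "0 < s"
    and max: "\<And>\<beta>' s'. 0 < s' \<Longrightarrow> lik f n (\<lambda>i. X i \<omega>) (\<lambda>i. Y i \<omega>) \<beta>' s'
                \<le> lik f n (\<lambda>i. X i \<omega>) (\<lambda>i. Y i \<omega>) \<beta> s"
    using lik_attains_max[OF f_nonneg f_tail f_cont \<open>0 < \<alpha>\<close> \<open>0 < C\<close> n_pos i ii] by metis
  have "is_mle f n (\<lambda>i. X i \<omega>) (\<lambda>i. Y i \<omega>) \<beta> s"
    unfolding is_mle_def is_arg_max_def
  proof (intro conjI notI)
    assume "\<exists>q. q \<in> UNIV \<times> {0<..} \<and>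
      (case (\<beta>, s) of (b, r) \<Rightarrow> loglik f n (\<lambda>i. X i \<omega>) (\<lambda>i. Y i \<omega>) b r)
      < (case q of (b, r) \<Rightarrow> loglik f n (\<lambda>i. X i \<omega>) (\<lambda>i. Y i \<omega>) b r)"
    then obtain \<beta>' s' where s': "0 < s'"
      and "loglik f n (\<lambda>i. X i \<omega>) (\<lambda>i. Y i \<omega>) \<beta> s < loglik f n (\<lambda>i. X i \<omega>) (\<lambda>i. Y i \<omega>) \<beta>' s'"
      by auto
    \<comment> \<open>Monotonicity of \<open>elog\<close> carries maximality from the likelihood to
      the log-likelihood, including the value -\<infinity>.\<close>
    with elog_mono[OF max[OF s']] show False
      by (simp add: loglik_eq_elog_lik[OF f_nonneg s] loglik_eq_elog_lik[OF f_nonneg s'] flip: not_le)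
  qed (use s in simp)
  then show ?thesis by blast
qed

end
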